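(* Let $k\ge 2$ be an integer and let $\mathcal{E}_k\subset\mathbf{P}^3$ be the surface $X^k+Y^k=Z^k+W^k$. (i) The even case. Assume that $k=2m$ is even, and let $(X:Y:Z:W)\in\mathcal{E}_k(\mathbf{Q})$ with $ZW\neq 0$. Define $$a=\frac{X^k-W^k}{Z^mW^m},\qquad b=-\Bigl(\frac{W}{Z}\Bigr)^m,\qquad c=\frac{Y^k-W^k}{Z^mW^m},\qquad d=\Bigl(\frac{Z}{W}\Bigr)^m.$$ Then $$ab+1=\Bigl(\frac{Y}{Z}\Bigr)^k,\quad ac+1=\Bigl(\frac{XY}{ZW}\Bigr)^k,\quad ad+1=\Bigl(\frac{X}{W}\Bigr)^k,\quad bc+1=\Bigl(\frac{X}{Z}\Bigr)^k,\quad bd+1=0,\quad cd+1=\Bigl(\frac{Y}{W}\Bigr)^k.$$ (ii) The odd case. Assume that $k$ is odd, and let $(X:Y:Z:W)\in\mathcal{E}_k(\mathbf{Q})$ with $ZW\neq 0$. Suppose in addition that $\frac{W}{Z}=\lambda^2$ for some $\lambda\in\mathbf{Q}^\times$. Define $$a=\frac{X^k-W^k}{\lambda^kZ^k},\qquad b=-\lambda^k,\qquad c=\frac{Y^k-W^k}{\lambda^kZ^k},\qquad d=\lambda^{-k}.$$ Then $$ab+1=\Bigl(\frac{Y}{Z}\Bigr)^k,\quad ac+1=\Bigl(\frac{XY}{ZW}\Bigr)^k,\quad ad+1=\Bigl(\frac{X}{W}\Bigr)^k,\quad bc+1=\Bigl(\frac{X}{Z}\Bigr)^k,\quad bd+1=0,\quad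 cd+1=\Bigl(\frac{Y}{W}\Bigr)^k.$$ In both cases, if $$XYZW\,(X^k-Y^k)(X^k-W^k)(Y^k-W^k)\neq 0,$$ then the resulting numbers $a,b,c,d$ are pairwise distinct and nonzero, and hence form a $k$th power rational Diophantine quadruple.
   Context: For an integer $k\ge 2$, a $k$th power rational Diophantine quadruple is a set of four pairwise distinct nonzero rational numbers $\{a_1,a_2,a_3,a_4\}$ such that for every $1\le i<j\le 4$ the number $a_ia_j+1$ is a $k$th power in $\mathbf{Q}$ (where $0=0^k$ counts as a $k$th power). $\mathcal{E}_k(\mathbf{Q})$ denotes the set of rational points of $\mathcal{E}_k$ in $\mathbf{P}^3(\mathbf{Q})$. *)

theory Defs
  imports Complex_Main "HOL-Computational_Algebra.Nth_Powers"
begin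

text \<open>
  Rational projective 3-space is the set of classes of nonzero quadruples of rationals modulo
  scaling by a nonzero rational.
\<close>

definition proj3_rel :: "((rat \<times> rat \<times> rat \<times> rat) \<times> (rat \<times> rat \<times> rat \<times> rat)) set" where
  "proj3_rel = {((x, y, z, w), (x', y', z', w')).
     (x, y, z, w) \<noteq> (0, 0, 0, 0) \<and>
     (\<exists>t. t \<noteq> 0 \<and> x' = t * x \<and> y' = t * y \<and> z' = t * z \<and> w' = t * w)}"

definition proj3 :: "(rat \<times> rat \<times> rat \<times> rat) set set" where
  "proj3 = (UNIV - {(0, 0, 0, 0)}) // proj3_rel"

text \<open>
  The point \<open>(x : y : z : w)\<close>. For \<open>x = y = z = w = 0\<close> this is the empty set, which does not
  belong to \<^const>\<open>proj3\<close>.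
\<close>

definition proj3_point :: "rat \<Rightarrow> rat \<Rightarrow> rat \<Rightarrow> rat \<Rightarrow> (rat \<times> rat \<times> rat \<times> rat) set" where
  "proj3_point x y z w = proj3_rel `` {(x, y, z, w)}"

text \<open>
  The rational points of the surface \<open>X ^ k + Y ^ k = Z ^ k + W ^ k\<close>. The equation is homogeneous,
  so it holds for one representative of a point iff it holds for all of them.
\<close>

definition E_surface :: "nat \<Rightarrow> (rat \<times> rat \<times> rat \<times> rat) set set" where
  "E_surface k = {p \<in> proj3. \<forall>(x, y, z, w) \<in> p. x ^ k + y ^ k = z ^ k + w ^ k}"

definition rat_diophantine_quadruple :: "nat \<Rightarrow> rat set \<Rightarrow> bool" where
  "rat_diophantine_quadruple k S \<longleftrightarrow>
     card S = 4 \<and> 0 \<notin> S \<and> (\<forall>x\<in>S. \<forall>y\<in>S. x \<noteq> y \<longrightarrow> is_nth_power k (x * y + 1))"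

end

theory Submission
  imports Defs
begin

text \<open>
  Both cases are one computation. With \<open>x = X ^ k\<close>, \<open>y = Y ^ k\<close>, \<open>z = Z ^ k\<close>, \<open>w = W ^ k\<close>, the point
  gives \<open>x + y = z + w\<close>, and the extra hypothesis of each case provides a square root \<open>s\<close> of \<open>w / z\<close>,
  namely \<open>s = (W / Z) ^ m\<close> for even \<open>k = 2 * m\<close> and \<open>s = l ^ k\<close> for odd \<open>k\<close>. The four numbers are then
  \<open>(x - w) / (s * z)\<close>, \<open>- s\<close>, \<open>(y - w) / (s * z)\<close>, \<open>1 / s\<close>.
\<close>

text \<open>Scaling by 1 puts a nonzero quadruple into its own class, and \<open>E_surface\<close>
  imposes the equation on every representative.\<close>

lemma E_surface_point_eq:
  assumes "proj3_point X Y Z W \<in> E_surface k" and "(X, Y, Z, W) \<noteq> (0, 0, 0, 0)"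
  shows "X ^ k + Y ^ k = Z ^ k + W ^ k"
proof -
  have "((X, Y, Z, W), (X, Y, Z, W)) \<in> proj3_rel"
    using assms(2) by (auto simp: proj3_rel_def intro!: exI[of _ 1])
  then have "(X, Y, Z, W) \<in> proj3_point X Y Z W"
    by (simp add: proj3_point_def)
  then show ?thesis
    using assms(1) by (auto simp: E_surface_def)
qed

text \<open>For instance \<open>a * c + 1\<close> has numerator
  \<open>(x - w) * (y - w) + z * w\<close> over \<open>z * w = (s * z)\<^sup>2\<close>, and
  \<open>x + y = z + w\<close> reduces the numerator to \<open>x * y\<close>.\<close>

lemma quadruple_identities:
  fixes x y z s :: "'a::field"
  assumes "s \<noteq> 0" "z \<noteq> 0" and w: "w = s\<^sup>2 * z" and sum: "x + y = z + w"
    and a: "a = (x - w) / (s * z)" and b: "b = - s"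
    and c: "c = (y - w) / (s * z)" and d: "d = 1 / s"
  shows "a * b + 1 = y / z" "a * c + 1 = (x * y) / (z * w)" "a * d + 1 = x / w"
    "b * c + 1 = x / z" "b * d + 1 = 0" "c * d + 1 = y / w"
proof -
  \<comment> \<open>Eliminating \<open>w\<close> and \<open>y\<close> leaves rational identities in
    free \<open>x\<close>, \<open>z\<close>, \<open>s\<close>.\<close>
  have y: "y = z + s\<^sup>2 * z - x"
    using sum w by (simp add: algebra_simps)
  show "a * b + 1 = y / z" "a * c + 1 = (x * y) / (z * w)" "a * d + 1 = x / w"
    "b * c + 1 = x / z" "b * d + 1 = 0" "c * d + 1 = y / w"
    unfolding a b c d w y using assms(1,2)
    by (simp_all add: field_simps power2_eq_square)
qed

lemma quadruple_distinct_nonzero: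
  fixes x y z s :: "'a::linordered_field"
  assumes "s \<noteq> 0" "z \<noteq> 0" and w: "w = s\<^sup>2 * z" and sum: "x + y = z + w"
    and a: "a = (x - w) / (s * z)" and b: "b = - s"
    and c: "c = (y - w) / (s * z)" and d: "d = 1 / s"
    and ne: "x \<noteq> 0" "y \<noteq> 0" "x \<noteq> y" "x \<noteq> w" "y \<noteq> w"
  shows "distinct [a, b, c, d]" "a \<noteq> 0" "b \<noteq> 0" "c \<noteq> 0" "d \<noteq> 0"
proof -
  note eqs = quadruple_identities[OF assms(1-8)]
  have w0: "w \<noteq> 0"
    using assms(1,2) w by simp
  \<comment> \<open>This is where the order enters: \<open>b = d\<close> with
    \<open>b * d = - 1\<close> would make -1 a square.\<close>
  have sq: "t * t + 1 \<noteq> 0" for t :: 'a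
    using zero_le_square[of t] by linarith
  show nz: "a \<noteq> 0" "b \<noteq> 0" "c \<noteq> 0" "d \<noteq> 0"
    using assms(1,2) ne a b c d by auto
  have "a \<noteq> c"
    using assms(1,2) ne a c by (auto simp: field_simps)
  moreover have "b \<noteq> d"
    using eqs(5) sq by auto
  \<comment> \<open>As \<open>b * d = - 1\<close>, \<open>a\<close> or \<open>c\<close> being \<open>b\<close> or \<open>d\<close> would make one of the nonzero values
    \<open>x / w\<close>, \<open>y / w\<close>, \<open>x / z\<close>, \<open>y / z\<close> vanish.\<close>
  moreover have "a \<noteq> b" "a \<noteq> d" "c \<noteq> b" "c \<noteq> d"
    using eqs ne assms(2) w0 by (auto simp: mult.commute)
  ultimately show "distinct [a, b, c, d]"
    by auto
qed

lemma rat_diophantine_quadrupleI: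
  assumes "distinct [a, b, c, d]" "a \<noteq> 0" "b \<noteq> 0" "c \<noteq> 0" "d \<noteq> 0"
    and "is_nth_power k (a * b + 1)" "is_nth_power k (a * c + 1)" "is_nth_power k (a * d + 1)"
    and "is_nth_power k (b * c + 1)" "is_nth_power k (b * d + 1)" "is_nth_power k (c * d + 1)"
  shows "rat_diophantine_quadruple k {a, b, c, d}"
  using assms by (auto simp: rat_diophantine_quadruple_def mult.commute)

lemma surface_quadruple:
  fixes X Y Z W s :: rat
  assumes "k > 0" and point: "proj3_point X Y Z W \<in> E_surface k" and ZW: "Z * W \<noteq> 0"
    and s: "s\<^sup>2 = (W / Z) ^ k"
    and a: "a = (X ^ k - W ^ k) / (s * Z ^ k)" and b: "b = - s"
    and c: "c = (Y ^ k - W ^ k) / (s * Z ^ k)" and d: "d = 1 / s"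
  shows "a * b + 1 = (Y / Z) ^ k \<and>
          a * c + 1 = ((X * Y) / (Z * W)) ^ k \<and>
          a * d + 1 = (X / W) ^ k \<and>
          b * c + 1 = (X / Z) ^ k \<and>
          b * d + 1 = 0 \<and>
          c * d + 1 = (Y / W) ^ k \<and>
          (X * Y * Z * W * (X ^ k - Y ^ k) * (X ^ k - W ^ k) * (Y ^ k - W ^ k) \<noteq> 0 \<longrightarrow>
             distinct [a, b, c, d] \<and> a \<noteq> 0 \<and> b \<noteq> 0 \<and> c \<noteq> 0 \<and> d \<noteq> 0 \<and>
             rat_diophantine_quadruple k {a, b, c, d})"
proof -
  have s0: "s \<noteq> 0" and z0: "Z ^ k \<noteq> 0" and w: "W ^ k = s\<^sup>2 * Z ^ k"
    using s ZW \<open>k > 0\<close> by (auto simp: power_divide)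
  have sum: "X ^ k + Y ^ k = Z ^ k + W ^ k"
    using E_surface_point_eq[OF point] ZW by auto
  \<comment> \<open>Folding turns quotients and products of \<open>k\<close>th powers into single
    \<open>k\<close>th powers.\<close>
  note eqs = quadruple_identities[OF s0 z0 w sum a b c d,
      folded power_divide power_mult_distrib]
  show ?thesis
  proof (intro conjI impI eqs)
    assume "X * Y * Z * W * (X ^ k - Y ^ k) * (X ^ k - W ^ k) * (Y ^ k - W ^ k) \<noteq> 0"
    then have ne: "X ^ k \<noteq> 0" "Y ^ k \<noteq> 0" "X ^ k \<noteq> Y ^ k" "X ^ k \<noteq> W ^ k" "Y ^ k \<noteq> W ^ k"
      by auto
    note dist = quadruple_distinct_nonzero[OF s0 z0 w sum a b c d ne]
    show "distinct [a, b, c, d]" "a \<noteq> 0" "b \<noteq> 0" "c \<noteq> 0" "d \<noteq> 0"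
      by (fact dist)+
    \<comment> \<open>The value \<open>b * d + 1 = 0\<close> is a \<open>k\<close>th power since
      \<open>k > 0\<close>; the other five are explicit powers.\<close>
    show "rat_diophantine_quadruple k {a, b, c, d}"
      using \<open>k > 0\<close> by (intro rat_diophantine_quadrupleI dist) (simp_all add: eqs)
  qed
qed

theorem theorem3p1:
  fixes k :: nat
  assumes "k \<ge> 2"
  shows
    "(\<forall>(m::nat) (X::rat) (Y::rat) (Z::rat) (W::rat) (a::rat) (b::rat) (c::rat) (d::rat).
        k = 2 * m \<longrightarrow>
        proj3_point X Y Z W \<in> E_surface k \<longrightarrow>
        Z * W \<noteq> 0 \<longrightarrow>
        a = (X ^ k - W ^ k) / (Z ^ m * W ^ m) \<longrightarrow>
        b = - ((W / Z) ^ m) \<longrightarrow>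
        c = (Y ^ k - W ^ k) / (Z ^ m * W ^ m) \<longrightarrow>
        d = (Z / W) ^ m \<longrightarrow>
          a * b + 1 = (Y / Z) ^ k \<and>
          a * c + 1 = ((X * Y) / (Z * W)) ^ k \<and>
          a * d + 1 = (X / W) ^ k \<and>
          b * c + 1 = (X / Z) ^ k \<and>
          b * d + 1 = 0 \<and>
          c * d + 1 = (Y / W) ^ k \<and>
          (X * Y * Z * W * (X ^ k - Y ^ k) * (X ^ k - W ^ k) * (Y ^ k - W ^ k) \<noteq> 0 \<longrightarrow>
             distinct [a, b, c, d] \<and> a \<noteq> 0 \<and> b \<noteq> 0 \<and> c \<noteq> 0 \<and> d \<noteq> 0 \<and>
             rat_diophantine_quadruple k {a, b, c, d}))
     \<and>
     (\<forall>(X::rat) (Y::rat) (Z::rat) (W::rat) (l::rat) (a::rat) (b::rat) (c::rat) (d::rat).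
        odd k \<longrightarrow>
        proj3_point X Y Z W \<in> E_surface k \<longrightarrow>
        Z * W \<noteq> 0 \<longrightarrow>
        l \<noteq> 0 \<longrightarrow>
        W / Z = l ^ 2 \<longrightarrow>
        a = (X ^ k - W ^ k) / (l ^ k * Z ^ k) \<longrightarrow>
        b = - (l ^ k) \<longrightarrow>
        c = (Y ^ k - W ^ k) / (l ^ k * Z ^ k) \<longrightarrow>
        d = l powi (- int k) \<longrightarrow>
          a * b + 1 = (Y / Z) ^ k \<and>
          a * c + 1 = ((X * Y) / (Z * W)) ^ k \<and>
          a * d + 1 = (X / W) ^ k \<and>
          b * c + 1 = (X / Z) ^ k \<and>
          b * d + 1 = 0 \<and>
          c * d + 1 = (Y / W) ^ k \<and>
          (X * Y * Z * W * (X ^ k - Y ^ k) * (X ^ k - W ^ k) * (Y ^ k - W ^ k) \<noteq> 0 \<longrightarrow>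
             distinct [a, b, c, d] \<and> a \<noteq> 0 \<and> b \<noteq> 0 \<and> c \<noteq> 0 \<and> d \<noteq> 0 \<and>
             rat_diophantine_quadruple k {a, b, c, d}))"
\<comment> \<open>The instantiated \<open>conjI\<close> splits only the even case from the odd one
  and keeps each conclusion whole, as \<open>surface_quadruple\<close> states it.\<close>
proof (intro conjI[of "\<forall>m. _ m" "\<forall>X. _ X"] allI impI, goal_cases)
  case (1 m X Y Z W a b c d)
  \<comment> \<open>Since \<open>Z ^ k = Z ^ m * Z ^ m\<close>, the stated denominator is
    \<open>s * Z ^ k\<close> for \<open>s = (W / Z) ^ m\<close>.\<close>
  have "(W / Z) ^ m * Z ^ k = Z ^ m * W ^ m"
    using 1(1,3) by (simp add: power_divide mult_2 power_add)
  moreover have "((W / Z) ^ m)\<^sup>2 = (W / Z) ^ k"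
    using 1(1) by (simp add: power_even_eq)
  moreover have "(Z / W) ^ m = 1 / (W / Z) ^ m"
    by (simp add: power_divide)
  ultimately show ?case
    using assms 1 by (intro surface_quadruple[where s = "(W / Z) ^ m"]) simp_all
next
  case (2 X Y Z W l a b c d)
  \<comment> \<open>Both sides are \<open>l ^ (2 * k)\<close>, because
    \<open>W / Z = l ^ 2\<close>.\<close>
  have "(l ^ k)\<^sup>2 = (W / Z) ^ k"
    unfolding 2(5) by (simp add: power_mult[symmetric] mult.commute)
  moreover have "l powi (- int k) = 1 / l ^ k"
    by (simp add: power_int_minus divide_inverse)
  ultimately show ?case
    using assms 2 by (intro surface_quadruple[where s = "l ^ k"]) simp_all
qed

end
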